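(* Let $X \subset \mathbb{P}^3$ (homogeneous coordinates $[a:b:x:y]$) be the degree-5 surface defined by $$x (a^2 + b^2) (a^2 + b^2 - 2 a x - 2 b y) = a (x^2 + y^2) (x^2 + y^2 - 2 a x - 2 b y).$$ Then $X$ is a rational surface, i.e. birational to $\mathbb{P}^2$ over $\mathbb{Q}$. Explicitly, the rational map $\mathbb{P}^2 \dashrightarrow X$, $[s:t:u]\mapsto[a:b:x:y]$, given by \begin{align*} a &= s^3t(s-2u),\\ b &= s\bigl(-s^2u(s-2u)+(t^2+u^2)(t^2-2su+u^2)\bigr),\\ x &= t(t^2+u^2)(t^2-2su+u^2),\\ y &= (t^2+u^2)\bigl(-s^2(s-2u)+u(t^2-2su+u^2)\bigr), \end{align*} is a birational map onto $X$, with rational inverse $X \dashrightarrow \mathbb{P}^2$, $[a:b:x:y]\mapsto[s:t:u]=[a^2+b^2 : bx-ay : ax+by]$.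
   Context: A rational surface is a surface admitting a birational isomorphism with $\mathbb{P}^2$ defined over $\mathbb{Q}$. *)

theory Defs
  imports "HOL-Analysis.Analysis" "HOL-Library.Poly_Mapping"
begin

text \<open>
  Varieties are taken in the classical sense: sets of points of projective space over the
  algebraically closed field of complex numbers, with the Zariski topology given by
  homogeneous polynomials with complex coefficients. A variety or a rational map is defined over
  the rationals if it can be given by homogeneous polynomials with rational coefficients.

  The projective space of dimension \<open>n - 1\<close> has homogeneous coordinates indexed by a finite
  type \<open>'n\<close> with \<open>n\<close> elements.
\<close>

type_synonym 'n mpoly = "('n \<Rightarrow>\<^sub>0 nat) \<Rightarrow>\<^sub>0 complex"

definition Var :: "'n \<Rightarrow> 'n mpoly" where
  "Var i = Poly_Mapping.single (Poly_Mapping.single i 1) 1"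

definition eval_mpoly :: "'n::finite mpoly \<Rightarrow> complex ^ 'n \<Rightarrow> complex" where
  "eval_mpoly p v =
    (\<Sum>m\<in>Poly_Mapping.keys p. Poly_Mapping.lookup p m * (\<Prod>i\<in>UNIV. (v $ i) ^ Poly_Mapping.lookup m i))"

definition homogeneous :: "nat \<Rightarrow> 'n::finite mpoly \<Rightarrow> bool" where
  "homogeneous d p \<longleftrightarrow> (\<forall>m\<in>Poly_Mapping.keys p. (\<Sum>i\<in>UNIV. Poly_Mapping.lookup m i) = d)"

definition over_Q :: "'n mpoly \<Rightarrow> bool" where
  "over_Q p \<longleftrightarrow> (\<forall>m. Poly_Mapping.lookup p m \<in> \<rat>)"

text \<open>A point of projective space is the set of all its homogeneous coordinate vectors.\<close>

definition proj_pt :: "complex ^ 'n::finite \<Rightarrow> (complex ^ 'n) set" where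
  "proj_pt v = {c *s v | c. c \<noteq> 0}"

definition proj_space :: "(complex ^ 'n::finite) set set" where
  "proj_space = proj_pt ` {v. v \<noteq> 0}"

definition zero_locus :: "'n::finite mpoly set \<Rightarrow> (complex ^ 'n) set set" where
  "zero_locus S = {P \<in> proj_space. \<forall>p\<in>S. \<forall>v\<in>P. eval_mpoly p v = 0}"

definition zariski_closed :: "(complex ^ 'n::finite) set set \<Rightarrow> bool" where
  "zariski_closed X \<longleftrightarrow> (\<exists>S. (\<forall>p\<in>S. \<exists>d. homogeneous d p) \<and> X = zero_locus S)"

definition zariski_irreducible :: "(complex ^ 'n::finite) set set \<Rightarrow> bool" where
  "zariski_irreducible X \<longleftrightarrow> X \<noteq> {} \<and>
    (\<forall>A B. zariski_closed A \<and> zariski_closed B \<and> X \<subseteq> A \<union> B \<longrightarrow> X \<subseteq> A \<or> X \<subseteq> B)"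

definition zariski_dense_in :: "(complex ^ 'n::finite) set set \<Rightarrow> (complex ^ 'n) set set \<Rightarrow> bool" where
  "zariski_dense_in A X \<longleftrightarrow> A \<subseteq> X \<and> (\<forall>C. zariski_closed C \<and> A \<subseteq> C \<longrightarrow> X \<subseteq> C)"

definition variety_over_Q :: "(complex ^ 'n::finite) set set \<Rightarrow> bool" where
  "variety_over_Q X \<longleftrightarrow> zariski_irreducible X \<and>
    (\<exists>S. (\<forall>p\<in>S. over_Q p \<and> (\<exists>d. homogeneous d p)) \<and> X = zero_locus S)"

text \<open>
  A tuple \<open>f\<close> of forms of equal degree gives the rational map \<open>P \<mapsto> [f\<^sub>1(P) : \<dots> : f\<^sub>m(P)]\<close>, defined
  wherever the forms do not vanish simultaneously. In \<open>rmap\<close>, all \<open>v \<in> P\<close> contribute the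
  same projective point.
\<close>

definition eval_tuple :: "('n::finite mpoly) ^ 'm::finite \<Rightarrow> complex ^ 'n \<Rightarrow> complex ^ 'm" where
  "eval_tuple f v = (\<chi> i. eval_mpoly (f $ i) v)"

definition rmap_dom :: "(complex ^ 'n::finite) set set \<Rightarrow> ('n mpoly) ^ 'm::finite \<Rightarrow> (complex ^ 'n) set set" where
  "rmap_dom X f = {P \<in> X. \<forall>v\<in>P. eval_tuple f v \<noteq> 0}"

definition rmap :: "('n::finite mpoly) ^ 'm::finite \<Rightarrow> (complex ^ 'n) set \<Rightarrow> (complex ^ 'm) set" where
  "rmap f P = (\<Union>v\<in>P. proj_pt (eval_tuple f v))"

definition rational_map_over_Q ::
  "(complex ^ 'n::finite) set set \<Rightarrow> (complex ^ 'm::finite) set set \<Rightarrow> ('n mpoly) ^ 'm \<Rightarrow> bool" where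
  "rational_map_over_Q X Y f \<longleftrightarrow> variety_over_Q X \<and> variety_over_Q Y \<and>
    (\<exists>d. \<forall>i. homogeneous d (f $ i)) \<and> (\<forall>i. over_Q (f $ i)) \<and>
    rmap_dom X f \<noteq> {} \<and> rmap f ` rmap_dom X f \<subseteq> Y"

definition dominant ::
  "(complex ^ 'n::finite) set set \<Rightarrow> (complex ^ 'm::finite) set set \<Rightarrow> ('n mpoly) ^ 'm \<Rightarrow> bool" where
  "dominant X Y f \<longleftrightarrow> zariski_dense_in (rmap f ` rmap_dom X f) Y"

text \<open>
  Dominance makes both composites rational maps with nonempty (hence dense) open domain.
\<close>

definition inverse_rational_maps_over_Q ::
  "(complex ^ 'n::finite) set set \<Rightarrow> (complex ^ 'm::finite) set set \<Rightarrow>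
    ('n mpoly) ^ 'm \<Rightarrow> ('m mpoly) ^ 'n \<Rightarrow> bool" where
  "inverse_rational_maps_over_Q X Y f g \<longleftrightarrow>
    rational_map_over_Q X Y f \<and> dominant X Y f \<and>
    rational_map_over_Q Y X g \<and> dominant Y X g \<and>
    (\<forall>P\<in>rmap_dom X f. rmap f P \<in> rmap_dom Y g \<longrightarrow> rmap g (rmap f P) = P) \<and>
    (\<forall>P\<in>rmap_dom Y g. rmap g P \<in> rmap_dom X f \<longrightarrow> rmap f (rmap g P) = P)"

definition birational_map_over_Q ::
  "(complex ^ 'n::finite) set set \<Rightarrow> (complex ^ 'm::finite) set set \<Rightarrow> ('n mpoly) ^ 'm \<Rightarrow> bool" where
  "birational_map_over_Q X Y f \<longleftrightarrow> (\<exists>g. inverse_rational_maps_over_Q X Y f g)"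

text \<open>
  Only surfaces embedded in three-dimensional projective space are needed; these are the
  irreducible hypersurfaces.
\<close>

definition surface_over_Q :: "(complex ^ 4) set set \<Rightarrow> bool" where
  "surface_over_Q X \<longleftrightarrow> variety_over_Q X \<and>
    (\<exists>d F. F \<noteq> 0 \<and> homogeneous d F \<and> over_Q F \<and> X = zero_locus {F})"

definition rational_surface :: "(complex ^ 4) set set \<Rightarrow> bool" where
  "rational_surface X \<longleftrightarrow> surface_over_Q X \<and>
    (\<exists>f. birational_map_over_Q (proj_space :: (complex ^ 3) set set) X f)"

end

theory Submission
  imports Defs "HOL-Computational_Algebra.Fundamental_Theorem_Algebra"
begin

text \<open>
  Write \<open>s = a\<^sup>2 + b\<^sup>2\<close>, \<open>t = b x - a y\<close>, \<open>u = a x + b y\<close> and \<open>q = x\<^sup>2 + y\<^sup>2\<close>. Then \<open>t\<^sup>2 + u\<^sup>2 = s q\<close>, and the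
  equation of the surface reads \<open>x s (s - 2 u) = a q (q - 2 u)\<close>. From this, the parametrization
  evaluated at \<open>(s, t, u)\<close> is proportional to \<open>(a, b, x, y)\<close>, with factor \<open>s\<^sup>3 t (s - 2 u) / a\<close>. In the
  other direction the composite multiplies \<open>(s, t, u)\<close> by a form of degree 9 for all \<open>s\<close>, \<open>t\<close>, \<open>u\<close>.

  The points of the surface where \<open>a\<close>, \<open>s\<close>, \<open>t\<close> and \<open>s - 2 u\<close> are nonzero are therefore in the image of
  the parametrization. They are dense for the Euclidean topology, by continuity of the roots of a
  polynomial whose leading coefficient is fixed, so the image is Zariski dense. The surface is
  irreducible because it is the closure of the image of an irreducible variety; this avoids
  factoring the quintic.
\<close>

section \<open>Polynomials and projective points\<close>

lemma poly_mapping_eq_sum_single: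
  "p = (\<Sum>m\<in>Poly_Mapping.keys p. Poly_Mapping.single m (Poly_Mapping.lookup p m))"
proof (rule poly_mapping_eqI)
  fix k
  show "Poly_Mapping.lookup p k = Poly_Mapping.lookup
      (\<Sum>m\<in>Poly_Mapping.keys p. Poly_Mapping.single m (Poly_Mapping.lookup p m)) k"
    by (simp add: lookup_sum lookup_single when_def in_keys_iff)
qed

text \<open>The product is defined as a convolution; a finite double sum of monomials lets
  evaluation and rationality of products be checked term by term.\<close>

lemma mpoly_mult_eq_sum_single:
  fixes p q :: "'n mpoly"
  shows "p * q = (\<Sum>m\<in>Poly_Mapping.keys p. \<Sum>n\<in>Poly_Mapping.keys q.
    Poly_Mapping.single (m + n) (Poly_Mapping.lookup p m * Poly_Mapping.lookup q n))"
proof -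
  have "p * q = (\<Sum>m\<in>Poly_Mapping.keys p. Poly_Mapping.single m (Poly_Mapping.lookup p m)) *
      (\<Sum>n\<in>Poly_Mapping.keys q. Poly_Mapping.single n (Poly_Mapping.lookup q n))"
    using poly_mapping_eq_sum_single[of p] poly_mapping_eq_sum_single[of q] by simp
  then show ?thesis
    by (simp add: sum_product mult_single)
qed

text \<open>Allows several polynomials to be evaluated over one common finite set of exponents,
  which makes additivity a termwise matter.\<close>

lemma eval_mpoly_superset:
  assumes "finite K" "Poly_Mapping.keys p \<subseteq> K"
  shows "eval_mpoly p v =
    (\<Sum>m\<in>K. Poly_Mapping.lookup p m * (\<Prod>i\<in>UNIV. (v $ i) ^ Poly_Mapping.lookup m i))"
  unfolding eval_mpoly_def using assms
  by (intro sum.mono_neutral_left) (auto simp: in_keys_iff)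

lemma eval_mpoly_0 [simp]: "eval_mpoly 0 v = 0"
  by (simp add: eval_mpoly_def)

lemma eval_mpoly_single:
  "eval_mpoly (Poly_Mapping.single m c) v = c * (\<Prod>i\<in>UNIV. (v $ i) ^ Poly_Mapping.lookup m i)"
  by (subst eval_mpoly_superset[of "{m}"]) auto

lemma eval_mpoly_1 [simp]: "eval_mpoly 1 v = 1"
  by (simp add: eval_mpoly_single flip: single_one)

lemma eval_mpoly_numeral [simp]: "eval_mpoly (numeral k) v = numeral k"
  by (simp add: eval_mpoly_single flip: single_numeral)

lemma eval_mpoly_Var [simp]: "eval_mpoly (Var i) v = v $ i"
proof -
  have "(\<Prod>j\<in>UNIV. (v $ j) ^ Poly_Mapping.lookup (Poly_Mapping.single i 1) j)
      = (\<Prod>j\<in>UNIV. if i = j then v $ j else 1)"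
    by (intro prod.cong) (auto simp: lookup_single when_def)
  then show ?thesis by (simp add: Var_def eval_mpoly_single)
qed

lemma eval_mpoly_add [simp]: "eval_mpoly (p + q) v = eval_mpoly p v + eval_mpoly q v"
proof -
  let ?K = "Poly_Mapping.keys p \<union> Poly_Mapping.keys q"
  have "eval_mpoly r v = (\<Sum>m\<in>?K. Poly_Mapping.lookup r m * (\<Prod>i\<in>UNIV. (v $ i) ^ Poly_Mapping.lookup m i))"
    if "r \<in> {p, q, p + q}" for r
    using that keys_add[of p q] by (intro eval_mpoly_superset) auto
  then show ?thesis by (simp add: lookup_add ring_distribs sum.distrib)
qed

lemma eval_mpoly_minus [simp]: "eval_mpoly (- p) v = - eval_mpoly p v"
  by (simp add: eval_mpoly_def sum_negf)

lemma eval_mpoly_diff [simp]: "eval_mpoly (p - q) v = eval_mpoly p v - eval_mpoly q v"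
  using eval_mpoly_add[of p "- q" v] by simp

lemma eval_mpoly_sum: "eval_mpoly (sum f A) v = (\<Sum>x\<in>A. eval_mpoly (f x) v)"
  by (induction A rule: infinite_finite_induct) auto

lemma eval_mpoly_mult [simp]: "eval_mpoly (p * q) v = eval_mpoly p v * eval_mpoly q v"
  unfolding mpoly_mult_eq_sum_single eval_mpoly_sum eval_mpoly_single
  by (simp add: eval_mpoly_def sum_product lookup_add power_add prod.distrib mult_ac)

lemma eval_mpoly_power [simp]: "eval_mpoly (p ^ k) v = eval_mpoly p v ^ k"
  by (induction k) auto

lemma continuous_on_eval_mpoly: "continuous_on A (eval_mpoly p)"
  unfolding eval_mpoly_def[abs_def] by (intro continuous_intros)

section \<open>Homogeneity and rationality of coefficients\<close>

lemma eval_mpoly_homogeneous: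
  assumes "homogeneous d p"
  shows "eval_mpoly p (c *s v) = c ^ d * eval_mpoly p v"
  using assms unfolding eval_mpoly_def homogeneous_def sum_distrib_left
  by (intro sum.cong) (auto simp: power_mult_distrib prod.distrib power_sum[symmetric])

lemma homogeneous_numeral: "homogeneous 0 (numeral k)"
  unfolding homogeneous_def single_numeral[symmetric] keys_single by auto

lemma homogeneous_Var: "homogeneous (Suc 0) (Var i)"
  by (auto simp: homogeneous_def Var_def lookup_single when_def)

lemma homogeneous_add: "homogeneous d p \<Longrightarrow> homogeneous d q \<Longrightarrow> homogeneous d (p + q)"
  using keys_add[of p q] unfolding homogeneous_def by blast

lemma homogeneous_minus: "homogeneous d p \<Longrightarrow> homogeneous d (- p)"
  unfolding homogeneous_def by simp

lemma homogeneous_diff: "homogeneous d p \<Longrightarrow> homogeneous d q \<Longrightarrow> homogeneous d (p - q)"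
  using homogeneous_add[of d p "- q"] homogeneous_minus[of d q] by simp

lemma homogeneous_mult:
  "homogeneous d p \<Longrightarrow> homogeneous e q \<Longrightarrow> k = d + e \<Longrightarrow> homogeneous k (p * q)"
  using keys_mult[of p q] unfolding homogeneous_def
  by (fastforce simp: lookup_add sum.distrib)

lemma homogeneous_power: "homogeneous d p \<Longrightarrow> e = d * k \<Longrightarrow> homogeneous e (p ^ k)"
proof (induction k arbitrary: e)
  case 0
  then show ?case by (simp add: homogeneous_def)
next
  case (Suc k)
  then show ?case by (auto intro: homogeneous_mult[of d])
qed

lemma over_Q_add: "over_Q p \<Longrightarrow> over_Q q \<Longrightarrow> over_Q (p + q)"
  by (simp add: over_Q_def lookup_add)

lemma over_Q_minus: "over_Q p \<Longrightarrow> over_Q (- p)"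
  by (simp add: over_Q_def)

lemma over_Q_diff: "over_Q p \<Longrightarrow> over_Q q \<Longrightarrow> over_Q (p - q)"
  by (simp add: over_Q_def lookup_minus)

lemma over_Q_numeral: "over_Q (numeral k)"
  by (simp add: over_Q_def lookup_numeral when_def)

lemma over_Q_Var: "over_Q (Var i)"
  by (simp add: over_Q_def Var_def lookup_single when_def)

lemma over_Q_mult: "over_Q p \<Longrightarrow> over_Q q \<Longrightarrow> over_Q (p * q)"
  unfolding mpoly_mult_eq_sum_single over_Q_def lookup_sum lookup_single when_def
  by (auto intro!: Rats_sum)

lemma over_Q_power: "over_Q p \<Longrightarrow> over_Q (p ^ k)"
proof (induction k)
  case 0
  show ?case by (simp add: over_Q_def lookup_one when_def)
qed (simp add: over_Q_mult)

section \<open>Tuples of forms, projective points and closed sets\<close>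

lemma eval_tuple_nth [simp]: "eval_tuple f v $ i = eval_mpoly (f $ i) v"
  by (simp add: eval_tuple_def)

lemma eval_tuple_homogeneous:
  assumes "\<forall>i. homogeneous d (f $ i)"
  shows "eval_tuple f (c *s v) = c ^ d *s eval_tuple f v"
  using assms by (simp add: vec_eq_iff eval_mpoly_homogeneous)

lemma proj_pt_scale: "c \<noteq> 0 \<Longrightarrow> proj_pt (c *s v) = proj_pt v"
proof -
  assume c: "c \<noteq> 0"
  have "\<exists>e. d *s v = e *s (c *s v) \<and> e \<noteq> 0" if "d \<noteq> 0" for d
    using that c by (intro exI[of _ "d / c"]) simp
  then show ?thesis using c by (force simp: proj_pt_def)
qed

lemma proj_pt_self: "v \<in> proj_pt v"
  unfolding proj_pt_def by (auto intro!: exI[of _ 1])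

lemma proj_space_cases:
  assumes "P \<in> proj_space"
  obtains v where "v \<noteq> 0" "P = proj_pt v"
  using assms by (auto simp: proj_space_def)

lemma proj_pt_in_zero_locus_iff:
  assumes "\<forall>p\<in>S. \<exists>d. homogeneous d p" "v \<noteq> 0"
  shows "proj_pt v \<in> zero_locus S \<longleftrightarrow> (\<forall>p\<in>S. eval_mpoly p v = 0)"
proof -
  have "proj_pt v \<in> proj_space" using assms(2) by (auto simp: proj_space_def)
  moreover have "eval_mpoly p w = 0" if "p \<in> S" "eval_mpoly p v = 0" "w \<in> proj_pt v" for p w
    using assms(1) that by (auto simp: proj_pt_def eval_mpoly_homogeneous)
  ultimately show ?thesis unfolding zero_locus_def using proj_pt_self by blast
qed

text \<open>Rescaling a representative multiplies all values by the same nonzero factor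
  \<open>c ^ d\<close>, so one representative decides for the whole point.\<close>

lemma proj_pt_in_rmap_dom_iff:
  assumes "\<forall>i. homogeneous d (f $ i)"
  shows "proj_pt v \<in> rmap_dom X f \<longleftrightarrow> proj_pt v \<in> X \<and> eval_tuple f v \<noteq> 0"
proof -
  have "eval_tuple f w \<noteq> 0" if "eval_tuple f v \<noteq> 0" "w \<in> proj_pt v" for w
    using that by (auto simp: proj_pt_def eval_tuple_homogeneous[OF assms])
  then show ?thesis unfolding rmap_dom_def using proj_pt_self by blast
qed

lemma rmap_proj_pt:
  assumes "\<forall>i. homogeneous d (f $ i)"
  shows "rmap f (proj_pt v) = proj_pt (eval_tuple f v)"
proof -
  have "proj_pt (eval_tuple f w) = proj_pt (eval_tuple f v)" if "w \<in> proj_pt v" for w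
    using that by (auto simp: proj_pt_def[of v] eval_tuple_homogeneous[OF assms] proj_pt_scale)
  then show ?thesis unfolding rmap_def using proj_pt_self by blast
qed

text \<open>One of the forms cutting out \<open>A\<close> already fails at \<open>v\<close>;
  arguments about closed sets thus reduce to a single polynomial.\<close>

lemma not_in_zariski_closedE:
  assumes "zariski_closed A" "v \<noteq> 0" "proj_pt v \<notin> A"
  obtains p where "eval_mpoly p v \<noteq> 0" "\<And>w. w \<noteq> 0 \<Longrightarrow> proj_pt w \<in> A \<Longrightarrow> eval_mpoly p w = 0"
proof -
  from assms(1) obtain S where S: "\<forall>p\<in>S. \<exists>d. homogeneous d p" "A = zero_locus S"
    by (auto simp: zariski_closed_def)
  with assms obtain p where "p \<in> S" "eval_mpoly p v \<noteq> 0"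
    by (auto simp: proj_pt_in_zero_locus_iff)
  with S that show thesis by (auto simp: proj_pt_in_zero_locus_iff)
qed

section \<open>Functions that are polynomial on every line\<close>

text \<open>This weak notion replaces the fact that multivariate polynomials form an integral
  domain: it survives composition with tuples of forms, and restriction to a line reduces questions
  to one variable.\<close>

definition line_polynomial :: "(complex ^ 'n \<Rightarrow> complex) \<Rightarrow> bool" where
  "line_polynomial f \<longleftrightarrow> (\<forall>v w. \<exists>p. \<forall>z. f (v + z *s w) = poly p z)"

lemma line_polynomialE:
  assumes "line_polynomial f"
  obtains p where "\<And>z. f (v + z *s w) = poly p z"
  using assms unfolding line_polynomial_def by metis

lemma line_polynomial_const: "line_polynomial (\<lambda>v. c)"
  unfolding line_polynomial_def by (metis poly_const_conv)

lemma line_polynomial_nth: "line_polynomial (\<lambda>v :: complex ^ 'n. v $ i)"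
  unfolding line_polynomial_def
proof (intro allI)
  fix v w :: "complex ^ 'n"
  show "\<exists>p. \<forall>z. (v + z *s w) $ i = poly p z"
    by (rule exI[of _ "[:v $ i, w $ i:]"]) simp
qed

lemma line_polynomial_add:
  fixes f g :: "complex ^ 'n \<Rightarrow> complex"
  assumes "line_polynomial f" "line_polynomial g"
  shows "line_polynomial (\<lambda>v. f v + g v)"
  unfolding line_polynomial_def
proof (intro allI)
  fix v w :: "complex ^ 'n"
  obtain p where "\<And>z. f (v + z *s w) = poly p z" using line_polynomialE[OF assms(1)] by metis
  moreover obtain q where "\<And>z. g (v + z *s w) = poly q z" using line_polynomialE[OF assms(2)] by metis
  ultimately show "\<exists>p. \<forall>z. f (v + z *s w) + g (v + z *s w) = poly p z"
    by (intro exI[of _ "p + q"]) simp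
qed

lemma line_polynomial_mult:
  fixes f g :: "complex ^ 'n \<Rightarrow> complex"
  assumes "line_polynomial f" "line_polynomial g"
  shows "line_polynomial (\<lambda>v. f v * g v)"
  unfolding line_polynomial_def
proof (intro allI)
  fix v w :: "complex ^ 'n"
  obtain p where "\<And>z. f (v + z *s w) = poly p z" using line_polynomialE[OF assms(1)] by metis
  moreover obtain q where "\<And>z. g (v + z *s w) = poly q z" using line_polynomialE[OF assms(2)] by metis
  ultimately show "\<exists>p. \<forall>z. f (v + z *s w) * g (v + z *s w) = poly p z"
    by (intro exI[of _ "p * q"]) simp
qed

lemma line_polynomial_sum:
  "(\<And>x. x \<in> A \<Longrightarrow> line_polynomial (f x)) \<Longrightarrow> line_polynomial (\<lambda>v. \<Sum>x\<in>A. f x v)"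
  by (induction A rule: infinite_finite_induct) (auto intro: line_polynomial_add line_polynomial_const)

lemma line_polynomial_prod:
  "(\<And>x. x \<in> A \<Longrightarrow> line_polynomial (f x)) \<Longrightarrow> line_polynomial (\<lambda>v. \<Prod>x\<in>A. f x v)"
  by (induction A rule: infinite_finite_induct) (auto intro: line_polynomial_mult line_polynomial_const)

lemma line_polynomial_power: "line_polynomial f \<Longrightarrow> line_polynomial (\<lambda>v. f v ^ k)"
  by (induction k) (auto intro: line_polynomial_mult line_polynomial_const)

lemma line_polynomial_eval_mpoly_comp:
  assumes "\<And>i. line_polynomial (\<lambda>v. \<phi> v $ i)"
  shows "line_polynomial (\<lambda>v. eval_mpoly p (\<phi> v))"
  unfolding eval_mpoly_def
  by (intro line_polynomial_sum line_polynomial_mult line_polynomial_const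
      line_polynomial_prod line_polynomial_power assms)

lemma line_polynomial_eval_mpoly: "line_polynomial (eval_mpoly p)"
  using line_polynomial_eval_mpoly_comp[of "\<lambda>v. v" p] by (simp add: line_polynomial_nth)

lemma line_polynomial_eval_tuple: "line_polynomial (\<lambda>v. eval_mpoly p (eval_tuple f v))"
  by (intro line_polynomial_eval_mpoly_comp) (simp add: line_polynomial_eval_mpoly)

text \<open>On the line through \<open>v\<close> and \<open>w\<close> both functions become nonzero
  polynomials, as seen at the parameters 0 and 1. Their product is nonzero and so has a
  non-root.\<close>

lemma line_polynomial_common_nonzero:
  assumes "line_polynomial f" "line_polynomial g" "f v \<noteq> 0" "g w \<noteq> 0"
  obtains x where "f x \<noteq> 0" "g x \<noteq> 0"
proof -
  obtain p where p: "\<And>z. f (v + z *s (w - v)) = poly p z" using line_polynomialE[OF assms(1)] by metis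
  obtain q where q: "\<And>z. g (v + z *s (w - v)) = poly q z" using line_polynomialE[OF assms(2)] by metis
  have "p \<noteq> 0" using p[of 0] assms(3) by auto
  moreover have "q \<noteq> 0" using q[of 1] assms(4) by auto
  ultimately obtain z where "poly (p * q) z \<noteq> 0"
    using poly_all_0_iff_0[of "p * q"] by auto
  then show thesis using that[of "v + z *s (w - v)"] by (simp only: p q poly_mult) simp
qed

text \<open>If neither \<open>A\<close> nor \<open>B\<close> contained \<open>Y\<close>, density
  would give polynomials vanishing on \<open>A\<close> and on \<open>B\<close> whose pullbacks along
  \<open>f\<close> are not identically zero. A common nonzero point of the pullbacks maps into
  \<open>Y\<close> but outside \<open>A \<union> B\<close>.\<close>

lemma zariski_irreducible_of_dense_image:
  fixes f :: "('n::finite mpoly) ^ 'm::finite"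
  assumes hom: "\<forall>i. homogeneous d (f $ i)"
    and ne: "rmap_dom proj_space f \<noteq> {}"
    and dense: "zariski_dense_in (rmap f ` rmap_dom proj_space f) Y"
  shows "zariski_irreducible Y"
  unfolding zariski_irreducible_def
proof (intro conjI allI impI)
  show "Y \<noteq> {}" using ne dense by (auto simp: zariski_dense_in_def)
next
  fix A B
  assume AB: "zariski_closed A \<and> zariski_closed B \<and> Y \<subseteq> A \<union> B"
  have pull: "\<exists>p v. v \<noteq> 0 \<and> eval_tuple f v \<noteq> 0 \<and> eval_mpoly p (eval_tuple f v) \<noteq> 0 \<and>
      (\<forall>w. w \<noteq> 0 \<longrightarrow> proj_pt w \<in> C \<longrightarrow> eval_mpoly p w = 0)"
    if "zariski_closed C" "\<not> Y \<subseteq> C" for C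
  proof -
    from that dense obtain P where P: "P \<in> rmap_dom proj_space f" "rmap f P \<notin> C"
      unfolding zariski_dense_in_def by blast
    then obtain v where v: "v \<noteq> 0" "P = proj_pt v"
      by (auto simp: rmap_dom_def elim: proj_space_cases)
    then have "eval_tuple f v \<noteq> 0" using P proj_pt_in_rmap_dom_iff[OF hom] by blast
    then show ?thesis
      using not_in_zariski_closedE[of C "eval_tuple f v"] that P v rmap_proj_pt[OF hom] by metis
  qed
  show "Y \<subseteq> A \<or> Y \<subseteq> B"
  proof (rule ccontr)
    assume "\<not> (Y \<subseteq> A \<or> Y \<subseteq> B)"
    then obtain p v q w where p: "v \<noteq> 0" "eval_tuple f v \<noteq> 0" "eval_mpoly p (eval_tuple f v) \<noteq> 0"
        "\<forall>w. w \<noteq> 0 \<longrightarrow> proj_pt w \<in> A \<longrightarrow> eval_mpoly p w = 0"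
      and q: "eval_mpoly q (eval_tuple f w) \<noteq> 0"
        "\<forall>w. w \<noteq> 0 \<longrightarrow> proj_pt w \<in> B \<longrightarrow> eval_mpoly q w = 0"
      using pull AB by meson
    from p(1,2) obtain i j where ij: "v $ i \<noteq> 0" "eval_tuple f v $ j \<noteq> 0"
      by (auto simp: vec_eq_iff)
    \<comment> \<open>The extra factors force the common point to be a nonzero vector at which
      \<open>f\<close> is nonzero, hence a point of the domain.\<close>
    let ?h = "\<lambda>v. eval_mpoly p (eval_tuple f v) * (v $ i * eval_mpoly (f $ j) v)"
    have "line_polynomial ?h"
      by (intro line_polynomial_mult line_polynomial_eval_tuple line_polynomial_nth line_polynomial_eval_mpoly)
    moreover have "?h v \<noteq> 0" using p(3) ij by simp
    ultimately obtain x where x: "?h x \<noteq> 0" "eval_mpoly q (eval_tuple f x) \<noteq> 0"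
      using q(1) by (rule line_polynomial_common_nonzero[OF _ line_polynomial_eval_tuple])
    then have x0: "x \<noteq> 0" "eval_tuple f x \<noteq> 0" by (auto simp: vec_eq_iff)
    then have "proj_pt x \<in> rmap_dom proj_space f"
      using proj_pt_in_rmap_dom_iff[OF hom] by (auto simp: proj_space_def)
    then have "proj_pt (eval_tuple f x) \<in> Y"
      using dense unfolding zariski_dense_in_def rmap_proj_pt[OF hom, symmetric] by blast
    then show False using AB p(4) q(2) x x0 by auto
  qed
qed

lemma variety_over_Q_proj_space: "variety_over_Q (proj_space :: (complex ^ 'n::finite) set set)"
  unfolding variety_over_Q_def
proof
  \<comment> \<open>Projective space is the image of its identity map, so irreducibility is an
    instance of the lemma on dense images.\<close>
  define f :: "('n mpoly) ^ 'n" where "f = (\<chi> i. Var i)"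
  have hom: "\<forall>i. homogeneous 1 (f $ i)" by (simp add: f_def homogeneous_Var)
  have f: "eval_tuple f v = v" for v by (simp add: f_def vec_eq_iff)
  have dom: "rmap_dom proj_space f = proj_space"
  proof
    show "proj_space \<subseteq> rmap_dom proj_space f"
    proof
      fix P :: "(complex ^ 'n) set"
      assume P: "P \<in> proj_space"
      then obtain v where "v \<noteq> 0" "P = proj_pt v" by (rule proj_space_cases)
      with P show "P \<in> rmap_dom proj_space f" by (simp add: proj_pt_in_rmap_dom_iff[OF hom] f)
    qed
  qed (auto simp: rmap_dom_def)
  have "rmap f ` proj_space = proj_space"
    by (auto simp: proj_space_def image_iff rmap_proj_pt[OF hom] f)
  moreover have "axis i 1 \<noteq> (0 :: complex ^ 'n)" for i by (simp add: axis_eq_0_iff)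
  ultimately show "zariski_irreducible (proj_space :: (complex ^ 'n) set set)"
    using dom by (intro zariski_irreducible_of_dense_image[OF hom])
      (auto simp: zariski_dense_in_def proj_space_def)
  show "\<exists>S. (\<forall>p\<in>S. over_Q p \<and> (\<exists>d. homogeneous d p)) \<and> (proj_space :: (complex ^ 'n) set set) = zero_locus S"
    by (rule exI[of _ "{}"]) (simp add: zero_locus_def)
qed

section \<open>Continuity of roots\<close>

text \<open>Up to sign, the constant term is the leading coefficient times the product of the roots,
  and each factor is at least as large in norm as the smallest root \<open>z\<close>.\<close>

lemma poly_small_root:
  fixes p :: "complex poly"
  assumes "degree p > 0"
  obtains z where "poly p z = 0" "norm (lead_coeff p) * norm z ^ degree p \<le> norm (poly p 0)"
proof -
  from assms obtain A where A: "size A = degree p" "p = smult (lead_coeff p) (\<Prod>x\<in>#A. [:-x, 1:])"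
    using alg_closed_imp_factorization[of p] by force
  have ev: "poly p z = lead_coeff p * (\<Prod>x\<in>#A. z - x)" for z
    by (subst A(2)) (simp add: poly_prod_mset)
  have bound: "r ^ size B \<le> norm (\<Prod>x\<in>#B. 0 - x)" if "\<forall>x\<in>#B. r \<le> norm x" "0 \<le> r"
    for B :: "complex multiset" and r
    using that by (induction B) (auto simp: norm_mult intro!: mult_mono)
  have "A \<noteq> {#}" using A(1) assms by auto
  then have fin: "finite (norm ` set_mset A)" "norm ` set_mset A \<noteq> {}" by auto
  then obtain z where z: "z \<in># A" "norm z = Min (norm ` set_mset A)"
    by (metis (no_types) Min_in imageE)
  then have "\<forall>x\<in>#A. norm z \<le> norm x" using Min_le[OF fin(1)] by auto
  then have "norm z ^ degree p \<le> norm (\<Prod>x\<in>#A. 0 - x)" using bound[of A "norm z"] A(1) by simp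
  moreover have "poly p z = 0" using z(1) by (auto simp: ev prod_mset_zero_iff)
  ultimately show thesis
    using that by (simp add: ev[of 0] norm_mult mult_left_mono)
qed

text \<open>With leading coefficient and degree fixed, the smallest root has norm at most the
  \<open>d\<close>-th root of \<open>norm (poly (p n) 0) / norm c\<close>, which tends to 0.\<close>

lemma roots_tendsto_0:
  fixes p :: "nat \<Rightarrow> complex poly"
  assumes "\<And>n. degree (p n) = d" "\<And>n. lead_coeff (p n) = c" "c \<noteq> 0" "d > 0"
    and "(\<lambda>n. poly (p n) 0) \<longlonglongrightarrow> 0"
  obtains z where "\<And>n. poly (p n) (z n) = 0" "z \<longlonglongrightarrow> 0"
proof -
  have "\<exists>z. poly (p n) z = 0 \<and> norm c * norm z ^ d \<le> norm (poly (p n) 0)" for n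
    using poly_small_root[of "p n"] assms(1)[of n] assms(2)[of n] \<open>d > 0\<close> by metis
  then obtain z where z: "\<And>n. poly (p n) (z n) = 0"
      "\<And>n. norm c * norm (z n) ^ d \<le> norm (poly (p n) 0)" by metis
  have le: "norm (z n) \<le> root d (norm (poly (p n) 0) / norm c)" for n
  proof -
    have "norm (z n) ^ d \<le> norm (poly (p n) 0) / norm c"
      using z(2)[of n] \<open>c \<noteq> 0\<close> by (simp add: field_simps)
    then have "root d (norm (z n) ^ d) \<le> root d (norm (poly (p n) 0) / norm c)"
      using \<open>d > 0\<close> by (simp only: real_root_le_iff)
    then show ?thesis using \<open>d > 0\<close> by (simp add: real_root_power_cancel)
  qed
  have "(\<lambda>n. root d (norm (poly (p n) 0) / norm c)) \<longlonglongrightarrow> root d (norm (0::complex) / norm c)"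
    by (intro tendsto_intros assms) (use \<open>c \<noteq> 0\<close> in auto)
  then have "(\<lambda>n. root d (norm (poly (p n) 0) / norm c)) \<longlonglongrightarrow> 0" by simp
  with le have "z \<longlonglongrightarrow> 0" by (rule Lim_null_comparison[OF always_eventually[rule_format]])
  with z(1) that show thesis by blast
qed

section \<open>The quintic surface\<close>

lemma vector_4_nth [simp]:
  "(vector [x, y, z, w] :: ('a::zero) ^ 4) $ 1 = x"
  "(vector [x, y, z, w] :: ('a::zero) ^ 4) $ 2 = y"
  "(vector [x, y, z, w] :: ('a::zero) ^ 4) $ 3 = z"
  "(vector [x, y, z, w] :: ('a::zero) ^ 4) $ 4 = w"
  by (simp_all add: vector_def)

text \<open>Vanishing of the 2 by 2 minors gives proportionality without naming the factor; the
  factor is read off at a nonzero coordinate of \<open>v\<close>.\<close>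

lemma proj_pt_eqI:
  assumes "v \<noteq> 0" "w \<noteq> 0" "\<forall>i j. w $ i * v $ j = w $ j * v $ i"
  shows "proj_pt w = proj_pt v"
proof -
  obtain i where i: "v $ i \<noteq> 0" using assms(1) by (auto simp: vec_eq_iff)
  then have w: "w = (w $ i / v $ i) *s v"
    using assms(3) by (simp add: vec_eq_iff field_simps)
  then have "w $ i / v $ i \<noteq> 0" using assms(2) by (metis vector_smult_lzero)
  then show ?thesis using w proj_pt_scale by metis
qed

section \<open>The quintic, the parametrization and their polynomial identities\<close>

definition quintic :: "complex \<Rightarrow> complex \<Rightarrow> complex \<Rightarrow> complex \<Rightarrow> complex" where
  "quintic a b x y = x * (a\<^sup>2 + b\<^sup>2) * (a\<^sup>2 + b\<^sup>2 - 2 * a * x - 2 * b * y)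
    - a * (x\<^sup>2 + y\<^sup>2) * (x\<^sup>2 + y\<^sup>2 - 2 * a * x - 2 * b * y)"

definition par_a :: "complex \<Rightarrow> complex \<Rightarrow> complex \<Rightarrow> complex" where
  "par_a s t u = s ^ 3 * t * (s - 2 * u)"

definition par_b :: "complex \<Rightarrow> complex \<Rightarrow> complex \<Rightarrow> complex" where
  "par_b s t u = s * (- (s\<^sup>2) * u * (s - 2 * u) + (t\<^sup>2 + u\<^sup>2) * (t\<^sup>2 - 2 * s * u + u\<^sup>2))"

definition par_x :: "complex \<Rightarrow> complex \<Rightarrow> complex \<Rightarrow> complex" where
  "par_x s t u = t * (t\<^sup>2 + u\<^sup>2) * (t\<^sup>2 - 2 * s * u + u\<^sup>2)"

definition par_y :: "complex \<Rightarrow> complex \<Rightarrow> complex \<Rightarrow> complex" where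
  "par_y s t u = (t\<^sup>2 + u\<^sup>2) * (- (s\<^sup>2) * (s - 2 * u) + u * (t\<^sup>2 - 2 * s * u + u\<^sup>2))"

text \<open>The form of degree 9 by which the composite of the two maps, of degrees 5 and 2, scales
  \<open>(s, t, u)\<close>.\<close>

definition par_factor :: "complex \<Rightarrow> complex \<Rightarrow> complex \<Rightarrow> complex" where
  "par_factor s t u = s * (t\<^sup>2 + u\<^sup>2) *
    (s ^ 4 * (s - 2 * u)\<^sup>2 - 2 * s\<^sup>2 * u * (s - 2 * u) * (t\<^sup>2 - 2 * s * u + u\<^sup>2)
      + (t\<^sup>2 + u\<^sup>2) * (t\<^sup>2 - 2 * s * u + u\<^sup>2)\<^sup>2)"

lemma inverse_of_param:
  fixes s t u :: complex
  defines "a \<equiv> par_a s t u" and "b \<equiv> par_b s t u" and "x \<equiv> par_x s t u" and "y \<equiv> par_y s t u"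
    and "m \<equiv> par_factor s t u"
  shows "a\<^sup>2 + b\<^sup>2 = m * s" "b * x - a * y = m * t" "a * x + b * y = m * u"
    and "quintic a b x y = 0"
proof -
  \<comment> \<open>\<open>L\<close>, \<open>K\<close> and \<open>T\<close> are treated as
    independent variables to keep the identities small. Where the relation between \<open>T\<close>,
    \<open>t\<close> and \<open>u\<close> matters, the defect is a multiple of
    \<open>t\<^sup>2 + u\<^sup>2 - T\<close>.\<close>
  define L K T where "L = s - 2 * u" and "K = t\<^sup>2 - 2 * s * u + u\<^sup>2" and "T = t\<^sup>2 + u\<^sup>2"
  define N where "N = s ^ 4 * L\<^sup>2 - 2 * s\<^sup>2 * u * L * K + T * K\<^sup>2"
  have a: "a = s ^ 3 * t * L" and b: "b = s * (- (s\<^sup>2) * u * L + T * K)"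
    and x: "x = t * T * K" and y: "y = T * (- (s\<^sup>2) * L + u * K)" and m: "m = s * T * N"
    by (simp_all add: a_def b_def x_def y_def m_def par_a_def par_b_def par_x_def par_y_def
        par_factor_def L_def K_def T_def N_def)
  have "a\<^sup>2 + b\<^sup>2 - m * s = s ^ 6 * L\<^sup>2 * (t\<^sup>2 + u\<^sup>2 - T)"
    unfolding a b m N_def by algebra
  then show S: "a\<^sup>2 + b\<^sup>2 = m * s" by (simp add: T_def)
  show tt: "b * x - a * y = m * t"
    unfolding a b x y m N_def by algebra
  have "a * x + b * y - m * u = s ^ 3 * T * L * K * (t\<^sup>2 + u\<^sup>2 - T)"
    unfolding a b x y m N_def by algebra
  then show U: "a * x + b * y = m * u" by (simp add: T_def)
  have "x\<^sup>2 + y\<^sup>2 - T\<^sup>2 * N = T\<^sup>2 * K\<^sup>2 * (t\<^sup>2 + u\<^sup>2 - T)"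
    unfolding x y N_def by algebra
  then have Q: "x\<^sup>2 + y\<^sup>2 = T\<^sup>2 * N" by (simp add: T_def)
  have "a\<^sup>2 + b\<^sup>2 - 2 * a * x - 2 * b * y = m * L"
    unfolding L_def using S U by algebra
  moreover have "x\<^sup>2 + y\<^sup>2 - 2 * a * x - 2 * b * y = T * N * K"
  proof -
    have "x\<^sup>2 + y\<^sup>2 - 2 * a * x - 2 * b * y = T\<^sup>2 * N - 2 * (m * u)"
      using Q U by algebra
    moreover have "K = T - 2 * s * u" by (simp add: K_def T_def)
    ultimately show ?thesis unfolding m by algebra
  qed
  \<comment> \<open>Both terms of the quintic have become
    \<open>s ^ 3 * t * L * K * T ^ 3 * N\<^sup>2\<close>.\<close>
  ultimately show "quintic a b x y = 0"
    unfolding quintic_def S Q unfolding a x m by algebra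
qed

text \<open>These are the six minors of \<open>(a, b, x, y)\<close> and its image under the
  composite. On the surface they vanish, even where \<open>a = 0\<close>.\<close>

lemma param_of_inverse:
  fixes a b x y :: complex
  defines "s \<equiv> a\<^sup>2 + b\<^sup>2" and "t \<equiv> b * x - a * y" and "u \<equiv> a * x + b * y"
  assumes "quintic a b x y = 0"
  shows "a * par_b s t u = par_a s t u * b" "a * par_x s t u = par_a s t u * x"
    "a * par_y s t u = par_a s t u * y" "x * par_b s t u = par_x s t u * b"
    "x * par_y s t u = par_x s t u * y" "y * par_b s t u = par_y s t u * b"
proof -
  define L q K where "L = s - 2 * u" and "q = x\<^sup>2 + y\<^sup>2" and "K = q - 2 * u"
  have T: "t\<^sup>2 + u\<^sup>2 = s * q" unfolding s_def t_def u_def q_def by algebra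
  then have K: "t\<^sup>2 - 2 * s * u + u\<^sup>2 = s * K" unfolding K_def by algebra
  have F: "x * s * L = a * q * K"
    using assms(4) by (simp add: quintic_def L_def K_def q_def s_def u_def algebra_simps)
  \<comment> \<open>With \<open>z = a + i b\<close> and \<open>w = x + i y\<close>, these are for
    real arguments the real and imaginary parts of \<open>(u + i t) conj z = s conj w\<close> and
    \<open>(u + i t) w = q z\<close>, both consequences of
    \<open>z conj w = u + i t\<close>.\<close>
  have h: "t * b + a * u = x * s" "s * y - b * u = - a * t" "u * x - a * q = y * t" "b * q - u * y = x * t"
    unfolding s_def t_def u_def q_def by algebra+
  have p: "par_a s t u = s ^ 3 * t * L" "par_b s t u = s ^ 3 * (q * K - u * L)"
    "par_x s t u = s\<^sup>2 * t * q * K" "par_y s t u = s\<^sup>2 * q * (u * K - s * L)"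
    unfolding par_a_def par_b_def par_x_def par_y_def T K L_def by algebra+
  \<comment> \<open>Each minor is an explicit combination of the surface equation \<open>F\<close>
    and the relations \<open>h\<close>.\<close>
  have "a * par_b s t u - par_a s t u * b
      = s ^ 3 * (L * (x * s - (t * b + a * u)) + (a * q * K - x * s * L))"
    unfolding p by algebra
  then show "a * par_b s t u = par_a s t u * b" by (simp add: F h)
  have "a * par_x s t u - par_a s t u * x = s\<^sup>2 * t * (a * q * K - x * s * L)"
    unfolding p by algebra
  then show "a * par_x s t u = par_a s t u * x" by (simp add: F)
  have "a * par_y s t u - par_a s t u * y
      = s\<^sup>2 * (u * (a * q * K - x * s * L) + s * L * (u * x - a * q - y * t))"
    unfolding p by algebra
  then show "a * par_y s t u = par_a s t u * y" by (simp add: F h)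
  have "x * par_b s t u - par_x s t u * b
      = s\<^sup>2 * (q * K * (x * s - (t * b + a * u)) + u * (a * q * K - x * s * L))"
    unfolding p by algebra
  then show "x * par_b s t u = par_x s t u * b" by (simp add: F h)
  have "x * par_y s t u - par_x s t u * y
      = s\<^sup>2 * q * (K * (u * x - a * q - y * t) + (a * q * K - x * s * L))"
    unfolding p by algebra
  then show "x * par_y s t u = par_x s t u * y" by (simp add: F h)
  have "y * par_b s t u - par_y s t u * b
      = s\<^sup>2 * (s * L * (b * q - u * y - x * t) + q * K * (s * y - b * u + a * t) + t * (x * s * L - a * q * K))"
    unfolding p by algebra
  then show "y * par_b s t u = par_y s t u * b" by (simp add: F h)
qed

section \<open>Moving points along the affine cone over the quintic\<close>

definition quintic_form :: "complex ^ 4 \<Rightarrow> complex" where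
  "quintic_form v = quintic (v $ 1) (v $ 2) (v $ 3) (v $ 4)"

lemma quintic_tendsto:
  assumes "X \<longlonglongrightarrow> P"
  shows "(\<lambda>n. quintic_form (X n)) \<longlonglongrightarrow> quintic_form P"
  unfolding quintic_form_def quintic_def by (intro tendsto_intros assms)

text \<open>A small step \<open>e n\<close> along \<open>v\<close> leaves the cone, and a root
  \<open>z n\<close> along \<open>w\<close> returns to it. Since degree and leading coefficient
  along \<open>w\<close> do not depend on \<open>e\<close>, continuity of roots makes the correction
  tend to 0.\<close>

lemma quintic_perturb:
  assumes P: "quintic_form P = 0"
    and p: "\<And>e. \<exists>p. degree p = d \<and> lead_coeff p = c \<and> 
      (\<forall>z. poly p z = quintic_form (P + e *s v + z *s w))"
    and "c \<noteq> 0" "d > 0"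
  obtains e z where "\<And>n. e n = 1 / of_nat (Suc n)" "(\<lambda>n. P + e n *s v + z n *s w) \<longlonglongrightarrow> P"
    "\<And>n. quintic_form (P + e n *s v + z n *s w) = 0"
proof -
  define e :: "nat \<Rightarrow> complex" where "e n = 1 / of_nat (Suc n)" for n
  have e: "e \<longlonglongrightarrow> 0"
    unfolding e_def using LIMSEQ_Suc[OF lim_1_over_n] by blast
  obtain r where r: "\<And>n. degree (r n) = d" "\<And>n. lead_coeff (r n) = c"
    "\<And>n z. poly (r n) z = quintic_form (P + e n *s v + z *s w)"
  proof -
    have "\<forall>n. \<exists>p. degree p = d \<and> lead_coeff p = c \<and>
        (\<forall>z. poly p z = quintic_form (P + e n *s v + z *s w))"
      using p by blast
    from choice[OF this] that show thesis by blast
  qed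
  have lim: "(\<lambda>n. P + e n *s v + z n *s w) \<longlonglongrightarrow> P" if "z \<longlonglongrightarrow> 0" for z
  proof (rule vec_tendstoI)
    fix i
    have "(\<lambda>n. P $ i + e n * v $ i + z n * w $ i) \<longlonglongrightarrow> P $ i + 0 * v $ i + 0 * w $ i"
      by (intro tendsto_intros e that)
    then show "(\<lambda>n. (P + e n *s v + z n *s w) $ i) \<longlonglongrightarrow> P $ i" by simp
  qed
  \<comment> \<open>The constant terms are the quintic at \<open>P + e n *s v\<close>, which tends
    to its value 0 at \<open>P\<close>.\<close>
  have r0: "(\<lambda>n. poly (r n) 0) \<longlonglongrightarrow> 0"
    using quintic_tendsto[OF lim[of "\<lambda>_. 0"]] P by (simp add: r(3))
  obtain z where z: "\<And>n. poly (r n) (z n) = 0" "z \<longlonglongrightarrow> 0"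
    using roots_tendsto_0[OF r(1,2) \<open>c \<noteq> 0\<close> \<open>d > 0\<close> r0] by blast
  show thesis
    by (rule that[of e z, OF e_def lim[OF z(2)]]) (use z(1) r(3) in simp)
qed

text \<open>The first term contributes \<open>z ^ 5\<close>, the second has degree at most 4. The
  leading coefficient is thus independent of \<open>a\<close>, which makes this direction usable at
  points with \<open>a = 0\<close>.\<close>

lemma quintic_line_bx:
  "\<exists>p. degree p = 5 \<and> lead_coeff p = 1 \<and> (\<forall>z. poly p z = quintic a (b + z) (x + z) y)"
proof -
  let ?B = "[:b, 1:]" and ?X = "[:x, 1:]"
  let ?p = "?X * ([:a\<^sup>2:] + ?B * ?B) * ([:a\<^sup>2:] + ?B * ?B - smult (2 * a) ?X - smult (2 * y) ?B)
    - smult a ((?X * ?X + [:y\<^sup>2:]) * (?X * ?X + [:y\<^sup>2:] - smult (2 * a) ?X - smult (2 * y) ?B))"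
  have "poly ?p z = quintic a (b + z) (x + z) y" for z
    by (simp add: quintic_def power2_eq_square algebra_simps)
  moreover have "degree ?p = 5" "lead_coeff ?p = 1" by simp_all
  ultimately show ?thesis by blast
qed

text \<open>With \<open>a\<close> and \<open>b\<close> fixed, the first term has degree at most 2,
  so the top degree comes from \<open>- a * (x\<^sup>2 + y\<^sup>2)\<^sup>2\<close>.\<close>

lemma quintic_line_xy:
  assumes "a \<noteq> 0" "k\<^sup>2 + l\<^sup>2 \<noteq> 0"
  shows "\<exists>p. degree p = 4 \<and> lead_coeff p = - a * (k\<^sup>2 + l\<^sup>2)\<^sup>2 \<and>
    (\<forall>z. poly p z = quintic a b (x + z * k) (y + z * l))"
proof -
  define s u v where "s = a\<^sup>2 + b\<^sup>2" and "u = 2 * (a * x + b * y)" and "v = 2 * (a * k + b * l)"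
  define c d e where "c = x\<^sup>2 + y\<^sup>2" and "d = 2 * (x * k + y * l)" and "e = k\<^sup>2 + l\<^sup>2"
  let ?p = "smult s ([:x, k:] * [:s - u, - v:]) - smult a ([:c, d, e:] * [:c - u, d - v, e:])"
  have "poly ?p z = quintic a b (x + z * k) (y + z * l)" for z
  proof -
    have "c + z * (d + z * e) = (x + z * k)\<^sup>2 + (y + z * l)\<^sup>2"
      unfolding c_def d_def e_def by algebra
    moreover have "u + z * v = 2 * a * (x + z * k) + 2 * b * (y + z * l)"
      unfolding u_def v_def by algebra
    moreover have "poly ?p z = (x + z * k) * s * (s - (u + z * v))
        - a * (c + z * (d + z * e)) * (c + z * (d + z * e) - (u + z * v))"
      by (simp add: algebra_simps)
    ultimately show ?thesis by (simp add: quintic_def s_def diff_diff_eq)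
  qed
  moreover have "degree ?p = 4" "lead_coeff ?p = - a * e\<^sup>2"
    using assms by (simp_all add: e_def power2_eq_square)
  ultimately show ?thesis unfolding e_def by blast
qed

text \<open>Since \<open>v $ 1 = 0\<close>, the step along \<open>v\<close> keeps \<open>a\<close>,
  and with it the leading coefficient along \<open>(0, 0, k, l)\<close>.\<close>

lemma quintic_perturb_xy:
  assumes P: "quintic_form P = 0" and "P $ 1 \<noteq> 0" "k\<^sup>2 + l\<^sup>2 \<noteq> 0" "v $ 1 = 0"
  obtains e z where "\<And>n. e n = 1 / of_nat (Suc n)"
    "(\<lambda>n. P + e n *s v + z n *s vector [0, 0, k, l]) \<longlonglongrightarrow> P"
    "\<And>n. quintic_form (P + e n *s v + z n *s vector [0, 0, k, l]) = 0"
proof (rule quintic_perturb[OF P, of 4 "- (P $ 1) * (k\<^sup>2 + l\<^sup>2)\<^sup>2" v "vector [0, 0, k, l]"])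
  fix e
  show "\<exists>p. degree p = 4 \<and> lead_coeff p = - (P $ 1) * (k\<^sup>2 + l\<^sup>2)\<^sup>2 \<and>
      (\<forall>z. poly p z = quintic_form (P + e *s v + z *s vector [0, 0, k, l]))"
    using quintic_line_xy[OF assms(2,3), of "P $ 2 + e * v $ 2" "P $ 3 + e * v $ 3" "P $ 4 + e * v $ 4"]
      assms(4) by (simp add: quintic_form_def)
qed (use assms that in simp_all)

lemma closure_of_tendsto:
  fixes X :: "nat \<Rightarrow> 'a::first_countable_topology"
  assumes "X \<longlonglongrightarrow> P" "\<And>n. X n \<in> A"
  shows "P \<in> closure A"
  using assms by (auto simp: closure_sequential)

text \<open>
  Each step below moves a point of the cone in a direction along which one more of the four forms
  becomes nonzero, then returns to the cone along a direction on which that form is constant and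
  the quintic has a constant nonzero leading coefficient.
\<close>

lemma quintic_dense:
  "{v. quintic_form v = 0} \<subseteq> closure {v. quintic_form v = 0 \<and> v $ 1 \<noteq> 0 \<and>
    (v $ 1)\<^sup>2 + (v $ 2)\<^sup>2 \<noteq> 0 \<and> v $ 2 * v $ 3 - v $ 1 * v $ 4 \<noteq> 0 \<and>
    (v $ 1)\<^sup>2 + (v $ 2)\<^sup>2 - 2 * (v $ 1 * v $ 3 + v $ 2 * v $ 4) \<noteq> 0}"
proof -
  define s t u :: "complex ^ 4 \<Rightarrow> complex"
    where "s v = (v $ 1)\<^sup>2 + (v $ 2)\<^sup>2" and "t v = v $ 2 * v $ 3 - v $ 1 * v $ 4"
      and "u v = v $ 1 * v $ 3 + v $ 2 * v $ 4" for v
  define M0 M1 M2 M3 M4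
    where "M0 = {v. quintic_form v = 0}"
      and "M1 = {v. quintic_form v = 0 \<and> v $ 1 \<noteq> 0}"
      and "M2 = {v. quintic_form v = 0 \<and> v $ 1 \<noteq> 0 \<and> s v \<noteq> 0}"
      and "M3 = {v. quintic_form v = 0 \<and> v $ 1 \<noteq> 0 \<and> s v \<noteq> 0 \<and> t v \<noteq> 0}"
      and "M4 = {v. quintic_form v = 0 \<and> v $ 1 \<noteq> 0 \<and> s v \<noteq> 0 \<and> t v \<noteq> 0 \<and> s v - 2 * u v \<noteq> 0}"
  note defs = M0_def M1_def M2_def M3_def M4_def
  have "M0 \<subseteq> closure M1"
  proof
    fix P assume P: "P \<in> M0"
    show "P \<in> closure M1"
    proof (cases "P $ 1 = 0")
      case True
      \<comment> \<open>The return direction fixes \<open>a\<close>, so the new first coordinate is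
        exactly \<open>e n\<close>.\<close>
      let ?v = "vector [1, 0, 0, 0] :: complex ^ 4" and ?w = "vector [0, 1, 1, 0] :: complex ^ 4"
      have p: "\<exists>p. degree p = 5 \<and> lead_coeff p = 1 \<and>
          (\<forall>z. poly p z = quintic_form (P + e *s ?v + z *s ?w))" for e
        using quintic_line_bx[of "P $ 1 + e" "P $ 2" "P $ 3" "P $ 4"] by (simp add: quintic_form_def)
      obtain e z where e: "\<And>n. e n = 1 / of_nat (Suc n)" "(\<lambda>n. P + e n *s ?v + z n *s ?w) \<longlonglongrightarrow> P"
        "\<And>n. quintic_form (P + e n *s ?v + z n *s ?w) = 0"
        using quintic_perturb[OF _ p] P by (auto simp: defs)
      have "P + e n *s ?v + z n *s ?w \<in> M1" for n
        using e(3)[of n] True by (simp add: defs e(1) del: of_nat_Suc)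
      with e(2) show ?thesis by (rule closure_of_tendsto)
    qed (use P closure_subset[of M1] in \<open>auto simp: defs\<close>)
  qed
  moreover have "M1 \<subseteq> closure M2"
  proof
    fix P assume P: "P \<in> M1"
    show "P \<in> closure M2"
    proof (cases "s P = 0")
      case True
      then have b: "P $ 2 \<noteq> 0" using P by (auto simp: defs s_def)
      \<comment> \<open>This scales \<open>b\<close> by \<open>1 + e\<close>, turning
        \<open>s = 0\<close> into \<open>b\<^sup>2 * e * (2 + e)\<close>; the return along
        \<open>y\<close> leaves \<open>s\<close> alone.\<close>
      let ?v = "vector [0, P $ 2, 0, 0] :: complex ^ 4" and ?w = "vector [0, 0, 0, 1] :: complex ^ 4"
      obtain e z where e: "\<And>n. e n = 1 / of_nat (Suc n)" "(\<lambda>n. P + e n *s ?v + z n *s ?w) \<longlonglongrightarrow> P"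
        "\<And>n. quintic_form (P + e n *s ?v + z n *s ?w) = 0"
        using quintic_perturb_xy[of P 0 1 ?v] P by (auto simp: defs)
      have "P + e n *s ?v + z n *s ?w \<in> M2" for n
      proof -
        have "s (P + e n *s ?v + z n *s ?w) = s P + (P $ 2)\<^sup>2 * e n * (2 + e n)"
          by (simp add: s_def power2_eq_square algebra_simps)
        moreover have "Re (e n) > 0" by (simp add: e(1) del: of_nat_Suc)
        then have "e n \<noteq> 0" "2 + e n \<noteq> 0" by (auto simp: complex_eq_iff)
        ultimately show ?thesis using e(3)[of n] True b P by (simp add: defs)
      qed
      with e(2) show ?thesis by (rule closure_of_tendsto)
    qed (use P closure_subset[of M2] in \<open>auto simp: defs\<close>)
  qed
  moreover have "M2 \<subseteq> closure M3"
  proof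
    fix P assume P: "P \<in> M2"
    show "P \<in> closure M3"
    proof (cases "t P = 0")
      case True
      \<comment> \<open>The direction \<open>(-b, a)\<close> in the \<open>(x, y)\<close> plane
        changes \<open>t\<close> by \<open>- e * s\<close>, while \<open>(a, b)\<close> fixes
        \<open>t\<close>. The latter satisfies
        \<open>k\<^sup>2 + l\<^sup>2 = s \<noteq> 0\<close>.\<close>
      let ?v = "vector [0, 0, - (P $ 2), P $ 1] :: complex ^ 4"
        and ?w = "vector [0, 0, P $ 1, P $ 2] :: complex ^ 4"
      obtain e z where e: "\<And>n. e n = 1 / of_nat (Suc n)" "(\<lambda>n. P + e n *s ?v + z n *s ?w) \<longlonglongrightarrow> P"
        "\<And>n. quintic_form (P + e n *s ?v + z n *s ?w) = 0"
        using quintic_perturb_xy[of P "P $ 1" "P $ 2" ?v] P by (auto simp: defs s_def)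
      have "P + e n *s ?v + z n *s ?w \<in> M3" for n
      proof -
        have "t (P + e n *s ?v + z n *s ?w) = t P - e n * s P"
          "s (P + e n *s ?v + z n *s ?w) = s P"
          by (simp_all add: t_def s_def power2_eq_square algebra_simps)
        moreover have "e n \<noteq> 0" by (simp add: e(1) del: of_nat_Suc)
        ultimately show ?thesis using e(3)[of n] True P by (simp add: defs)
      qed
      with e(2) show ?thesis by (rule closure_of_tendsto)
    qed (use P closure_subset[of M3] in \<open>auto simp: defs\<close>)
  qed
  moreover have "M3 \<subseteq> closure M4"
  proof
    fix P assume P: "P \<in> M3"
    show "P \<in> closure M4"
    proof (cases "s P - 2 * u P = 0")
      case True
      \<comment> \<open>The two directions exchange roles: \<open>(a, b)\<close> changes
        \<open>u\<close> by \<open>e * s\<close>, and \<open>(-b, a)\<close> fixes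
        \<open>u\<close>.\<close>
      let ?v = "vector [0, 0, P $ 1, P $ 2] :: complex ^ 4"
        and ?w = "vector [0, 0, - (P $ 2), P $ 1] :: complex ^ 4"
      obtain e z where e: "\<And>n. e n = 1 / of_nat (Suc n)" "(\<lambda>n. P + e n *s ?v + z n *s ?w) \<longlonglongrightarrow> P"
        "\<And>n. quintic_form (P + e n *s ?v + z n *s ?w) = 0"
        using quintic_perturb_xy[of P "- (P $ 2)" "P $ 1" ?v] P by (auto simp: defs s_def add.commute)
      let ?X = "\<lambda>n. P + e n *s ?v + z n *s ?w"
      \<comment> \<open>The return direction does alter \<open>t\<close>, so \<open>t\<close> stays
        nonzero only for large \<open>n\<close>, by continuity.\<close>
      have "(\<lambda>n. t (?X n)) \<longlonglongrightarrow> t P" unfolding t_def by (intro tendsto_intros e(2))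
      then have "eventually (\<lambda>n. t (?X n) \<noteq> 0) sequentially"
        using P by (intro tendsto_imp_eventually_ne) (auto simp: defs)
      then have "eventually (\<lambda>n. ?X n \<in> closure M4) sequentially"
      proof (rule eventually_mono)
        fix n assume "t (?X n) \<noteq> 0"
        moreover have "u (?X n) = u P + e n * s P" "s (?X n) = s P"
          by (simp_all add: u_def s_def power2_eq_square algebra_simps)
        moreover have "e n \<noteq> 0" by (simp add: e(1) del: of_nat_Suc)
        ultimately have "?X n \<in> M4" using e(3)[of n] True P by (simp add: defs algebra_simps)
        then show "?X n \<in> closure M4" using closure_subset by blast
      qed
      then show ?thesis by (rule Lim_in_closed_set[OF closed_closure _ _ e(2)]) simp
    qed (use P closure_subset[of M4] in \<open>auto simp: defs\<close>)
  qed
  ultimately have "M0 \<subseteq> closure M4"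
    by (meson closed_closure closure_minimal subset_trans)
  then show ?thesis by (simp add: defs s_def t_def u_def)
qed

section \<open>The two rational maps: domains, dense images and mutual inversion\<close>

theorem theorem1p1:
  fixes s t u :: "3 mpoly" and a b x y F :: "4 mpoly"
    and X :: "(complex ^ 4) set set"
    and param :: "(3 mpoly) ^ 4" and inverse_param :: "(4 mpoly) ^ 3"
  assumes "s = Var 1" and "t = Var 2" and "u = Var 3"
    and "a = Var 1" and "b = Var 2" and "x = Var 3" and "y = Var 4"
    and "F = x * (a^2 + b^2) * (a^2 + b^2 - 2 * a * x - 2 * b * y)
           - a * (x^2 + y^2) * (x^2 + y^2 - 2 * a * x - 2 * b * y)"
    and "X = zero_locus {F}"
    and "param = vector
      [s^3 * t * (s - 2 * u),
       s * (- (s^2) * u * (s - 2 * u) + (t^2 + u^2) * (t^2 - 2 * s * u + u^2)),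
       t * (t^2 + u^2) * (t^2 - 2 * s * u + u^2),
       (t^2 + u^2) * (- (s^2) * (s - 2 * u) + u * (t^2 - 2 * s * u + u^2))]"
    and "inverse_param = vector [a^2 + b^2, b * x - a * y, a * x + b * y]"
  shows "F \<noteq> 0 \<and> homogeneous 5 F \<and> rational_surface X \<and>
    birational_map_over_Q proj_space X param \<and>
    inverse_rational_maps_over_Q proj_space X param inverse_param"
proof -
  let ?P2 = "proj_space :: (complex ^ 3) set set"
  note vars = assms(1-7)
  note hom_intros = homogeneous_add homogeneous_minus homogeneous_diff homogeneous_mult
    homogeneous_power homogeneous_numeral homogeneous_Var
  note rat_intros = over_Q_add over_Q_minus over_Q_diff over_Q_mult over_Q_power over_Q_numeral over_Q_Var

  have hom_F: "homogeneous 5 F"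
    unfolding assms(8) vars
    by (rule hom_intros | simp)+
  have rat_F: "over_Q F" unfolding assms(8) vars by (intro rat_intros)
  have hom_p: "\<forall>i. homogeneous 5 (param $ i)"
    unfolding assms(10) vars forall_4 vector_4_nth
    by (intro conjI; (rule hom_intros | simp)+)
  have rat_p: "\<forall>i. over_Q (param $ i)"
    unfolding assms(10) vars forall_4 vector_4_nth by (intro conjI rat_intros)
  have hom_i: "\<forall>i. homogeneous 2 (inverse_param $ i)"
    unfolding assms(11) vars forall_3 vector_3
    by (intro conjI; (rule hom_intros | simp)+)
  have rat_i: "\<forall>i. over_Q (inverse_param $ i)"
    unfolding assms(11) vars forall_3 vector_3 by (intro conjI rat_intros)

  have ev_F: "eval_mpoly F v = quintic_form v" for v
    by (simp add: assms(8) vars quintic_form_def quintic_def)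
  have ev_p: "eval_tuple param w $ 1 = par_a (w $ 1) (w $ 2) (w $ 3)"
    "eval_tuple param w $ 2 = par_b (w $ 1) (w $ 2) (w $ 3)"
    "eval_tuple param w $ 3 = par_x (w $ 1) (w $ 2) (w $ 3)"
    "eval_tuple param w $ 4 = par_y (w $ 1) (w $ 2) (w $ 3)" for w
    by (simp_all add: assms(10) vars par_a_def par_b_def par_x_def par_y_def)
  have ev_i: "eval_tuple inverse_param v $ 1 = (v $ 1)\<^sup>2 + (v $ 2)\<^sup>2"
    "eval_tuple inverse_param v $ 2 = v $ 2 * v $ 3 - v $ 1 * v $ 4"
    "eval_tuple inverse_param v $ 3 = v $ 1 * v $ 3 + v $ 2 * v $ 4" for v
    by (simp_all add: assms(11) vars)

  have in_X: "proj_pt v \<in> X \<longleftrightarrow> quintic_form v = 0" if "v \<noteq> 0" for v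
    using that hom_F by (subst assms(9), subst proj_pt_in_zero_locus_iff) (auto simp: ev_F)
  have X_cases: "\<exists>v. v \<noteq> 0 \<and> P = proj_pt v \<and> quintic_form v = 0" if "P \<in> X" for P
  proof -
    have "P \<in> proj_space" using that by (simp add: assms(9) zero_locus_def)
    then obtain v where "v \<noteq> 0" "P = proj_pt v" by (rule proj_space_cases)
    then show ?thesis using in_X that by blast
  qed

  let ?m = "\<lambda>w :: complex ^ 3. par_factor (w $ 1) (w $ 2) (w $ 3)"
  have ip: "eval_tuple inverse_param (eval_tuple param w) = ?m w *s w" for w
    unfolding vec_eq_iff forall_3 ev_i ev_p by (simp add: inverse_of_param)
  have p_in: "quintic_form (eval_tuple param w) = 0" for w
    unfolding quintic_form_def ev_p by (rule inverse_of_param)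
  have pi: "\<forall>i j. eval_tuple param (eval_tuple inverse_param v) $ i * v $ j
      = eval_tuple param (eval_tuple inverse_param v) $ j * v $ i" if "quintic_form v = 0" for v
    using param_of_inverse[OF that[unfolded quintic_form_def]]
    unfolding forall_4 ev_p ev_i by (simp add: mult.commute)

  \<comment> \<open>A sample point showing that the domains are nonempty: the factor
    \<open>?m w0\<close> equals 2.\<close>
  define w0 :: "complex ^ 3" where "w0 = vector [1, 1, 0]"
  have m0: "?m w0 \<noteq> 0" by (simp add: w0_def par_factor_def)
  \<comment> \<open>The inverse forms vanish at 0, so a nonzero composite requires
    \<open>param\<close> to be nonzero at \<open>w\<close>.\<close>
  have nz: "w \<noteq> 0 \<and> eval_tuple param w \<noteq> 0" if "?m w *s w \<noteq> 0" for w
  proof -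
    have "eval_tuple inverse_param 0 = 0" unfolding vec_eq_iff forall_3 ev_i by simp
    then show ?thesis using that ip[of w] by auto
  qed
  have w0: "?m w0 *s w0 \<noteq> 0"
    using m0 by (simp add: vec_eq_iff forall_3) (simp add: w0_def)

  have dom_p: "proj_pt w \<in> rmap_dom ?P2 param" if "w \<noteq> 0" "eval_tuple param w \<noteq> 0" for w
    using that by (auto simp: proj_pt_in_rmap_dom_iff[OF hom_p] proj_space_def)
  have dom_p_ne: "rmap_dom ?P2 param \<noteq> {}" using dom_p nz[OF w0] by blast
  have dom_p_cases: "\<exists>w. w \<noteq> 0 \<and> P = proj_pt w \<and> eval_tuple param w \<noteq> 0"
    if "P \<in> rmap_dom ?P2 param" for P
  proof -
    have "P \<in> ?P2" using that by (simp add: rmap_dom_def)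
    then obtain w where "w \<noteq> 0" "P = proj_pt w" by (rule proj_space_cases)
    then show ?thesis using that proj_pt_in_rmap_dom_iff[OF hom_p] by blast
  qed
  have im_p: "rmap param ` rmap_dom ?P2 param \<subseteq> X"
    using dom_p_cases in_X p_in by (fastforce simp: rmap_proj_pt[OF hom_p])

  have dom_i: "proj_pt (eval_tuple param w) \<in> rmap_dom X inverse_param" if "?m w *s w \<noteq> 0" for w
    using that nz[OF that] by (simp add: proj_pt_in_rmap_dom_iff[OF hom_i] ip in_X p_in)
  have dom_i_cases: "\<exists>v. v \<noteq> 0 \<and> P = proj_pt v \<and> quintic_form v = 0 \<and> eval_tuple inverse_param v \<noteq> 0"
    if "P \<in> rmap_dom X inverse_param" for P
  proof -
    have "P \<in> X" using that by (simp add: rmap_dom_def)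
    then show ?thesis using X_cases that proj_pt_in_rmap_dom_iff[OF hom_i] by blast
  qed
  have im_i: "rmap inverse_param ` rmap_dom X inverse_param \<subseteq> ?P2"
    using dom_i_cases by (fastforce simp: rmap_proj_pt[OF hom_i] proj_space_def)

  have dense_p: "zariski_dense_in (rmap param ` rmap_dom ?P2 param) X"
    unfolding zariski_dense_in_def
  proof (intro conjI allI impI im_p subsetI)
    fix C P
    assume C: "zariski_closed C \<and> rmap param ` rmap_dom ?P2 param \<subseteq> C" and "P \<in> X"
    then obtain v where v: "v \<noteq> 0" "P = proj_pt v" "quintic_form v = 0" using X_cases by blast
    show "P \<in> C"
    proof (rule ccontr)
      assume "P \<notin> C"
      then obtain g where g: "eval_mpoly g v \<noteq> 0"
        "\<And>w. w \<noteq> 0 \<Longrightarrow> proj_pt w \<in> C \<Longrightarrow> eval_mpoly g w = 0"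
        using not_in_zariski_closedE[of C v] C v by metis
      \<comment> \<open>At these points \<open>param\<close> after \<open>inverse_param\<close> has
        nonzero first coordinate \<open>s ^ 3 * t * (s - 2 * u)\<close>, so the minor criterion puts
        \<open>proj_pt v\<close> in the image. Hence \<open>g\<close> vanishes on
        \<open>?good\<close>, and by continuity on its Euclidean closure, which contains the
        cone.\<close>
      let ?good = "{v. quintic_form v = 0 \<and> v $ 1 \<noteq> 0 \<and>
        (v $ 1)\<^sup>2 + (v $ 2)\<^sup>2 \<noteq> 0 \<and> v $ 2 * v $ 3 - v $ 1 * v $ 4 \<noteq> 0 \<and>
        (v $ 1)\<^sup>2 + (v $ 2)\<^sup>2 - 2 * (v $ 1 * v $ 3 + v $ 2 * v $ 4) \<noteq> 0} :: (complex ^ 4) set"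
      have "?good \<subseteq> {v. eval_mpoly g v = 0}"
      proof
        fix v assume v: "v \<in> ?good"
        let ?w = "eval_tuple inverse_param v"
        have "v \<noteq> 0" using v by auto
        moreover have "?w $ 1 \<noteq> 0" using v unfolding ev_i by blast
        then have "?w \<noteq> 0" by (auto simp: vec_eq_iff)
        moreover have "eval_tuple param ?w $ 1 \<noteq> 0"
          using v unfolding ev_p ev_i par_a_def by simp
        then have "eval_tuple param ?w \<noteq> 0" by (auto simp: vec_eq_iff)
        ultimately have "proj_pt v \<in> rmap param ` rmap_dom ?P2 param"
          using proj_pt_eqI[of v "eval_tuple param ?w"] pi[of v] v dom_p[of ?w] rmap_proj_pt[OF hom_p, of ?w]
          by (metis (mono_tags, lifting) image_eqI mem_Collect_eq)
        then show "v \<in> {v. eval_mpoly g v = 0}" using g(2) C \<open>v \<noteq> 0\<close> by blast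
      qed
      moreover have "closed {v. eval_mpoly g v = 0}"
        by (intro closed_Collect_eq continuous_on_eval_mpoly continuous_on_const)
      ultimately have "closure ?good \<subseteq> {v. eval_mpoly g v = 0}" by (rule closure_minimal)
      then show False using quintic_dense v(3) g(1) by blast
    qed
  qed
  have irr_X: "zariski_irreducible X"
    by (rule zariski_irreducible_of_dense_image[OF hom_p dom_p_ne dense_p])
  have var_X: "variety_over_Q X"
    unfolding variety_over_Q_def using irr_X hom_F rat_F assms(9) by blast

  have dense_i: "zariski_dense_in (rmap inverse_param ` rmap_dom X inverse_param) ?P2"
    unfolding zariski_dense_in_def
  proof (intro conjI allI impI im_i subsetI)
    fix C :: "(complex ^ 3) set set" and P
    assume C: "zariski_closed C \<and> rmap inverse_param ` rmap_dom X inverse_param \<subseteq> C" and "P \<in> ?P2"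
    then obtain v where v: "v \<noteq> 0" "P = proj_pt v" by (auto elim: proj_space_cases)
    show "P \<in> C"
    proof (rule ccontr)
      assume "P \<notin> C"
      then obtain g where g: "eval_mpoly g v \<noteq> 0"
        "\<And>w. w \<noteq> 0 \<Longrightarrow> proj_pt w \<in> C \<Longrightarrow> eval_mpoly g w = 0"
        using not_in_zariski_closedE[of C v] C v by metis
      obtain i where i: "v $ i \<noteq> 0" using v by (auto simp: vec_eq_iff)
      have "line_polynomial (\<lambda>w. eval_mpoly g w * w $ i)"
        by (intro line_polynomial_mult line_polynomial_eval_mpoly line_polynomial_nth)
      \<comment> \<open>This coordinate is \<open>?m w * w $ 1\<close>. Where it is nonzero, the
        composite returns the point of \<open>w\<close>, which therefore lies in the image and in
        \<open>C\<close>.\<close>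
      moreover have "line_polynomial (\<lambda>w. eval_tuple inverse_param (eval_tuple param w) $ 1)"
        unfolding eval_tuple_nth by (rule line_polynomial_eval_tuple)
      moreover have "eval_mpoly g v * v $ i \<noteq> 0" using g i by simp
      moreover have "eval_tuple inverse_param (eval_tuple param w0) $ 1 \<noteq> 0"
        unfolding ip using m0 by (simp add: w0_def)
      ultimately obtain w where w: "eval_mpoly g w * w $ i \<noteq> 0"
        "eval_tuple inverse_param (eval_tuple param w) $ 1 \<noteq> 0"
        by (rule line_polynomial_common_nonzero)
      then have nz_w: "?m w *s w \<noteq> 0" unfolding ip by auto
      then have "proj_pt (?m w *s w) \<in> C"
        using C dom_i[OF nz_w] rmap_proj_pt[OF hom_i, of "eval_tuple param w"] unfolding ip by blast
      moreover have "?m w \<noteq> 0" using nz_w by auto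
      ultimately have "proj_pt w \<in> C" by (simp add: proj_pt_scale)
      then show False using g(2)[of w] nz[OF nz_w] w(1) by simp
    qed
  qed

  have round_p: "rmap inverse_param (rmap param P) = P"
    if P: "P \<in> rmap_dom ?P2 param" "rmap param P \<in> rmap_dom X inverse_param" for P
  proof -
    obtain w where w: "w \<noteq> 0" "P = proj_pt w" using dom_p_cases P(1) by blast
    then have "?m w *s w \<noteq> 0"
      using P(2) unfolding w rmap_proj_pt[OF hom_p] proj_pt_in_rmap_dom_iff[OF hom_i] ip by simp
    then have "?m w \<noteq> 0" by auto
    then show ?thesis
      unfolding w rmap_proj_pt[OF hom_p] rmap_proj_pt[OF hom_i] ip by (rule proj_pt_scale)
  qed
  have round_i: "rmap param (rmap inverse_param P) = P"
    if P: "P \<in> rmap_dom X inverse_param" "rmap inverse_param P \<in> rmap_dom ?P2 param" for P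
  proof -
    obtain v where v: "v \<noteq> 0" "P = proj_pt v" "quintic_form v = 0" using dom_i_cases P(1) by blast
    then have "eval_tuple param (eval_tuple inverse_param v) \<noteq> 0"
      using P(2) unfolding v(2) rmap_proj_pt[OF hom_i] proj_pt_in_rmap_dom_iff[OF hom_p] by simp
    then show ?thesis
      unfolding v(2) rmap_proj_pt[OF hom_i] rmap_proj_pt[OF hom_p]
      using proj_pt_eqI[OF v(1)] pi[OF v(3)] by blast
  qed

  have "rational_map_over_Q ?P2 X param"
    unfolding rational_map_over_Q_def
    using variety_over_Q_proj_space var_X hom_p rat_p dom_p_ne im_p by blast
  moreover have "rational_map_over_Q X ?P2 inverse_param"
    unfolding rational_map_over_Q_def
    using variety_over_Q_proj_space var_X hom_i rat_i dom_i[OF w0] im_i by blast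
  ultimately have inv: "inverse_rational_maps_over_Q ?P2 X param inverse_param"
    unfolding inverse_rational_maps_over_Q_def dominant_def
    using dense_p dense_i round_p round_i by blast
  then have bir: "birational_map_over_Q ?P2 X param" unfolding birational_map_over_Q_def by blast
  \<comment> \<open>The quintic takes the value 1 here.\<close>
  have "quintic_form (vector [0, 1, 1, 0]) \<noteq> 0" by (simp add: quintic_form_def quintic_def)
  then have "F \<noteq> 0" using ev_F by (metis eval_mpoly_0)
  then have "rational_surface X"
    unfolding rational_surface_def surface_over_Q_def using bir var_X hom_F rat_F assms(9) by blast
  with \<open>F \<noteq> 0\<close> hom_F bir inv show ?thesis by blast
qed

end
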